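(* Let $j\ge 1$ be a natural number. There exists a constant $C=C(j)>0$, depending only on $j$, such that for every $n\ge 1$, every $i\in\{1,\dots,n\}$ and every $u\in\mathcal{C}^{j+1}_c(\mathbb{R}^n)$ there exists a family $\mathcal{P}=\mathcal{P}(u)$ of measurable subsets of $\mathbb{R}^n$ of finite measure such that $$ \left|\frac{\partial^j u}{\partial x_i^j}(x)\right|\leq C \left(A_{\mathcal{P}}\left(\frac{\partial^{j+1} u}{\partial x_i^{j+1}}\right)(x)\right)^{\frac{j}{j+1}}\bigl(A_{\mathcal{P}}u(x)\bigr)^{\frac{1}{j+1}}\qquad\text{for all } x\in\mathbb{R}^n $$ and $$ \sum_{A\in\mathcal{P}}\chi_A(x)\leq 5\qquad\text{for all } x\in\mathbb{R}^n . $$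
   Context: $\mathcal{C}^{m}_c(\mathbb{R}^n)$ is the space of $m$ times continuously differentiable real functions with compact support; $\chi_A$ is the characteristic function of $A$. For a system $\mathcal{S}$ of measurable subsets of $\mathbb{R}^n$ of finite measure (and positive measure, so that averages make sense) and a locally integrable function $f$ on $\mathbb{R}^n$, the averaging operator over $\mathcal{S}$ is $$ A_{\mathcal{S}}f(x):=\sum_{A\in\mathcal{S}}\chi_A(x)\frac{1}{|A|}\int_A|f(s)|\,ds , $$ where $|A|$ is the Lebesgue measure of $A$. *)

theory Defs
  imports "HOL-Analysis.Analysis"
begin

text \<open>
  The dimension \<open>n\<close> has to be an ordinary variable (the constant of the theorem must not depend
  on it), so a point of \<open>\<real>\<^sup>n\<close> is a function \<open>nat \<Rightarrow> real\<close> with coordinates indexed by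
  \<open>{1..n}\<close> that is \<open>undefined\<close> elsewhere. This carrier is at once the topspace of
  \<open>Rn_top n\<close> and the space of \<open>Rn_lebesgue n\<close>.
\<close>

abbreviation Rn :: "nat \<Rightarrow> (nat \<Rightarrow> real) set" where
  "Rn n \<equiv> {1..n} \<rightarrow>\<^sub>E UNIV"

definition Rn_top :: "nat \<Rightarrow> (nat \<Rightarrow> real) topology" where
  "Rn_top n = product_topology (\<lambda>_. euclideanreal) {1..n}"

definition Rn_lebesgue :: "nat \<Rightarrow> (nat \<Rightarrow> real) measure" where
  "Rn_lebesgue n = completion (\<Pi>\<^sub>M k\<in>{1..n}. lborel)"

definition partial_deriv :: "nat \<Rightarrow> ((nat \<Rightarrow> real) \<Rightarrow> real) \<Rightarrow> (nat \<Rightarrow> real) \<Rightarrow> real" where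
  "partial_deriv i u x = deriv (\<lambda>t. u (x(i := t))) (x i)"

text \<open>
  \<open>m\<close> times continuously differentiable: all partial derivatives of order at most \<open>m\<close> exist and
  are continuous on \<open>\<real>\<^sup>n\<close>. Values of \<open>u\<close> outside \<open>Rn n\<close> are irrelevant.
\<close>

primrec Ck :: "nat \<Rightarrow> nat \<Rightarrow> ((nat \<Rightarrow> real) \<Rightarrow> real) \<Rightarrow> bool" where
  "Ck n 0 u \<longleftrightarrow> continuous_map (Rn_top n) euclideanreal u"
| "Ck n (Suc m) u \<longleftrightarrow>
     continuous_map (Rn_top n) euclideanreal u \<and>
     (\<forall>i\<in>{1..n}.
        (\<forall>x\<in>Rn n. (\<lambda>t. u (x(i := t))) differentiable (at (x i))) \<and>
        Ck n m (partial_deriv i u))"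

definition Ck_c :: "nat \<Rightarrow> nat \<Rightarrow> ((nat \<Rightarrow> real) \<Rightarrow> real) set" where
  "Ck_c n m = {u. Ck n m u \<and> compactin (Rn_top n) (Rn_top n closure_of {x \<in> Rn n. u x \<noteq> 0})}"

text \<open>
  Sums over a system of sets are unconditional sums in \<open>[0,\<infinity>]\<close>, so they always exist and
  a divergent sum is \<open>\<infinity>\<close>, not \<open>0\<close>.
\<close>

definition averaging_op ::
    "'a measure \<Rightarrow> 'a set set \<Rightarrow> ('a \<Rightarrow> real) \<Rightarrow> 'a \<Rightarrow> ennreal" where
  "averaging_op M S f x =
     (\<Sum>\<^sub>\<infinity>A\<in>S. indicator A x * (1 / emeasure M A * (\<integral>\<^sup>+s\<in>A. ennreal \<bar>f s\<bar> \<partial>M)))"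

end

theory Submission
  imports Defs
begin

text \<open>
  Let \<open>g\<close> be the \<open>j\<close>-th derivative of \<open>u\<close> in direction \<open>i\<close>. For \<open>m = 2 powr k\<close>, \<open>k\<close> an integer, let
  \<open>A\<close> be the union, over all lines in direction \<open>i\<close>, of those components of \<open>{m < \<bar>g\<bar> < 16 m}\<close>
  that meet \<open>{2 m < \<bar>g\<bar> < 8 m}\<close>. These sets are open and bounded, they cover \<open>{g \<noteq> 0}\<close>, and at
  most four of them meet at a point. On a component of length \<open>L\<close> the function \<open>g\<close> varies by at
  least \<open>m\<close>, so its derivative has integral at least \<open>m\<close>, while \<open>\<bar>g\<bar> \<ge> m\<close> forces the integral
  of \<open>\<bar>u\<bar>\<close> to be at least \<open>c m L ^ (j + 1)\<close>. Comparing \<open>L\<close> with \<open>l\<close>, the integral of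
  \<open>l \<bar>g'\<bar> + \<bar>u\<bar> / l ^ j\<close> over the component is at least \<open>c m L\<close> for every \<open>l > 0\<close>. This bound is
  additive, so it can be summed over components and integrated over the remaining coordinates
  without loss in the dimension. Dividing by the measure of \<open>A\<close> and optimising over \<open>l\<close> gives the
  multiplicative inequality for the averages over \<open>A\<close>.
\<close>

section \<open>Integral estimates on a single interval\<close>

text \<open>Induction on \<open>j\<close>: a difference whose step \<open>h\<close> is half the
  length lowers the order of the derivative by one and turns the bound \<open>m\<close> into
  \<open>m * h\<close>. Since \<open>b - a = 2 * h\<close>, passing from \<open>j\<close> to
  \<open>Suc j\<close> costs the factor \<open>2 ^ (j + 2)\<close>; these factors accumulate to the
  stated constant.\<close>

lemma lower_bound_integral_abs:
  fixes D :: "nat \<Rightarrow> real \<Rightarrow> real"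
  assumes "a \<le> b" "0 \<le> m"
    and "\<And>k x. k < j \<Longrightarrow> (D k has_real_derivative D (Suc k) x) (at x)"
    and "continuous_on UNIV (D 0)"
    and "\<And>x. x \<in> {a..b} \<Longrightarrow> m \<le> D j x"
  shows "m * (b - a) ^ (j + 1) \<le> 2 ^ (\<Sum>k<j. k + 2) * integral {a..b} (\<lambda>x. \<bar>D 0 x\<bar>)"
  using assms
proof (induction j arbitrary: D a b m)
  case 0
  have "integral {a..b} (\<lambda>x. m) \<le> integral {a..b} (\<lambda>x. \<bar>D 0 x\<bar>)"
    using 0 by (intro integral_le)
      (force intro!: integrable_continuous_real continuous_intros continuous_on_subset[OF "0.prems"(4)])+
  then show ?case using 0 by (simp add: mult.commute)
next
  case (Suc j)
  \<comment> \<open>pass to the difference \<open>D 0 (x + h) - D 0 x\<close> on the left half of the interval\<close>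
  define h where "h = (b - a) / 2"
  have h0: "0 \<le> h" and b: "b = a + h + h" using Suc.prems(1) by (auto simp: h_def field_simps)
  define E where "E k x = D k (x + h) - D k x" for k x
  have cont: "continuous_on A (D 0)" for A
    using Suc.prems(4) continuous_on_subset by blast
  have "(m * h) * ((a + h) - a) ^ (j + 1)
      \<le> 2 ^ (\<Sum>k<j. k + 2) * integral {a..a + h} (\<lambda>x. \<bar>E 0 x\<bar>)"
  proof (rule Suc.IH)
    show "(E k has_real_derivative E (Suc k) x) (at x)" if "k < j" for k x
      unfolding E_def using that Suc.prems(3)[of k]
      by (intro DERIV_diff DERIV_shift[THEN iffD1]) auto
    show "continuous_on UNIV (E 0)"
      unfolding E_def by (intro continuous_intros continuous_on_compose2[OF Suc.prems(4)]) auto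
    \<comment> \<open>Mean value theorem on \<open>{x..x + h}\<close>; the degenerate case
      \<open>h = 0\<close> is split off because it needs \<open>x < x + h\<close>.\<close>
    show "m * h \<le> E j x" if x: "x \<in> {a..a + h}" for x
    proof (cases "h = 0")
      case True
      then show ?thesis by (simp add: E_def)
    next
      case False
      then have "x < x + h" using h0 by simp
      then obtain z where z: "x < z" "z < x + h" "D j (x + h) - D j x = (x + h - x) * D (Suc j) z"
        using MVT2[of x "x + h" "D j" "D (Suc j)"] Suc.prems(3) by blast
      have "m \<le> D (Suc j) z" using z x b by (intro Suc.prems(5)) auto
      then show ?thesis unfolding E_def using z h0 by (simp add: mult.commute mult_left_mono)
    qed
  qed (use h0 Suc.prems in auto)
  \<comment> \<open>The two translates of \<open>\<bar>D 0 x\<bar>\<close> on the left half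
    contribute its integrals over the right and the left half, which together fill
    \<open>{a..b}\<close> exactly once.\<close>
  also have "integral {a..a + h} (\<lambda>x. \<bar>E 0 x\<bar>)
      \<le> integral {a..a + h} (\<lambda>x. \<bar>D 0 (x + h)\<bar> + \<bar>D 0 x\<bar>)"
    unfolding E_def
    by (intro integral_le integrable_continuous_real continuous_intros
        continuous_on_compose2[OF Suc.prems(4)]) auto
  also have "\<dots> = integral {a..a + h} (\<lambda>x. \<bar>D 0 (x + h)\<bar>) + integral {a..a + h} (\<lambda>x. \<bar>D 0 x\<bar>)"
    by (intro integral_add integrable_continuous_real continuous_intros
        continuous_on_compose2[OF Suc.prems(4)]) auto
  also have "integral {a..a + h} (\<lambda>x. \<bar>D 0 (x + h)\<bar>) = integral {a + h..a + h + h} (\<lambda>x. \<bar>D 0 x\<bar>)"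
    using integral_shift[of a h "a + h" "\<lambda>x. \<bar>D 0 x\<bar>"] cont by (simp add: comp_def continuous_intros)
  also have "\<dots> + integral {a..a + h} (\<lambda>x. \<bar>D 0 x\<bar>) = integral {a..b} (\<lambda>x. \<bar>D 0 x\<bar>)"
    unfolding b using h0 cont Henstock_Kurzweil_Integration.integral_combine[where a = a and c = "a + h" and b = "a + h + h" and f = "\<lambda>x. \<bar>D 0 x\<bar>"]
    by (simp add: integrable_continuous_real continuous_intros)
  finally have "m * h * h ^ (j + 1) \<le> 2 ^ (\<Sum>k<j. k + 2) * integral {a..b} (\<lambda>x. \<bar>D 0 x\<bar>)"
    by simp
  then have "2 ^ (j + 2) * (m * h * h ^ (j + 1))
      \<le> 2 ^ (j + 2) * (2 ^ (\<Sum>k<j. k + 2) * integral {a..b} (\<lambda>x. \<bar>D 0 x\<bar>))"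
    by (intro mult_left_mono) auto
  moreover have "b - a = 2 * h" by (simp add: b)
  ultimately show ?case by (simp add: power_mult_distrib power_add algebra_simps)
qed

text \<open>As \<open>0 < m\<close>, the function \<open>D j\<close> has no zero on the interval, so
  by connectedness it keeps one sign there; the negative case follows by passing to
  \<open>- D\<close>.\<close>

lemma lower_bound_integral_abs_of_abs:
  fixes D :: "nat \<Rightarrow> real \<Rightarrow> real"
  assumes "a \<le> b" "0 < m"
    and der: "\<And>k x. k < j \<Longrightarrow> (D k has_real_derivative D (Suc k) x) (at x)"
    and cont: "\<And>k. k \<le> j \<Longrightarrow> continuous_on UNIV (D k)"
    and m: "\<And>x. x \<in> {a..b} \<Longrightarrow> m \<le> \<bar>D j x\<bar>"
  shows "m * (b - a) ^ (j + 1) \<le> 2 ^ (\<Sum>k<j. k + 2) * integral {a..b} (\<lambda>x. \<bar>D 0 x\<bar>)"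
proof -
  have "connected (D j ` {a..b})"
    by (intro connected_continuous_image continuous_on_subset[OF cont]) auto
  moreover have "0 \<notin> D j ` {a..b}" using m \<open>0 < m\<close> by force
  ultimately have "(\<forall>x\<in>{a..b}. 0 \<le> D j x) \<or> (\<forall>x\<in>{a..b}. D j x \<le> 0)"
    by (smt (verit) connected_contains_Icc atLeastAtMost_iff image_eqI subsetD)
  then show ?thesis
  proof
    assume "\<forall>x\<in>{a..b}. 0 \<le> D j x"
    then show ?thesis using assms by (intro lower_bound_integral_abs) force+
  next
    assume *: "\<forall>x\<in>{a..b}. D j x \<le> 0"
    have "m * (b - a) ^ (j + 1) \<le> 2 ^ (\<Sum>k<j. k + 2) * integral {a..b} (\<lambda>x. \<bar>- D 0 x\<bar>)"
      using assms *
      by (intro lower_bound_integral_abs[where D = "\<lambda>k x. - D k x"])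
        (force intro!: derivative_intros continuous_intros)+
    then show ?thesis by simp
  qed
qed

lemma nn_integral_Ioo_eq_integral:
  fixes f :: "real \<Rightarrow> real"
  assumes "continuous_on UNIV f" "\<And>x. 0 \<le> f x"
  shows "(\<integral>\<^sup>+x\<in>{a<..<b}. ennreal (f x) \<partial>lborel) = ennreal (integral {a..b} f)"
proof -
  have m: "f \<in> borel_measurable borel" using assms(1) by (rule borel_measurable_continuous_onI)
  have "(f has_integral integral {a..b} f) {a..b}"
    by (intro integrable_integral integrable_continuous_real continuous_on_subset[OF assms(1)]) auto
  then have "(f has_integral integral {a..b} f) {a<..<b}"
    using has_integral_open_interval[of f _ a b] by simp
  then have "((\<lambda>x. f x * indicator {a<..<b} x) has_integral integral {a..b} f) UNIV"
    by (subst (asm) has_integral_restrict_UNIV[symmetric])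
      (erule has_integral_eq[rotated], auto simp: indicator_def)
  from nn_integral_has_integral_lborel[OF _ _ this] show ?thesis
    using m assms(2) by (simp add: ennreal_mult'' ennreal_indicator)
qed

text \<open>The variation between \<open>s\<close> and \<open>t\<close> bounds the integral of
  \<open>\<bar>D (Suc j) x\<bar>\<close> from below by \<open>m\<close>, and the preceding lemma
  bounds that of \<open>\<bar>D 0 x\<bar>\<close>. The result is linear in \<open>b - a\<close> so
  that it adds up over disjoint intervals.\<close>

lemma interval_estimate:
  fixes D :: "nat \<Rightarrow> real \<Rightarrow> real"
  assumes "a < b" "0 < m" "0 < l"
    and der: "\<And>k x. k \<le> j \<Longrightarrow> (D k has_real_derivative D (Suc k) x) (at x)"
    and cont: "continuous_on UNIV (D (Suc j))"
    and m: "\<And>x. x \<in> {a<..<b} \<Longrightarrow> m \<le> \<bar>D j x\<bar>"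
    and s: "s \<in> {a..b}" and t: "t \<in> {a..b}" and st: "m \<le> \<bar>D j s - D j t\<bar>"
  shows "m / 2 ^ (\<Sum>k<j. k + 2) * (b - a)
    \<le> integral {a..b} (\<lambda>x. l * \<bar>D (Suc j) x\<bar> + \<bar>D 0 x\<bar> / l ^ j)"
proof -
  have contD: "continuous_on A (D k)" if "k \<le> Suc j" for k A
  proof (cases "k = Suc j")
    case True
    then show ?thesis using cont continuous_on_subset by blast
  next
    case False
    then have "k \<le> j" using that by simp
    then show ?thesis
      using der DERIV_continuous_on has_field_derivative_at_within by metis
  qed
  let ?K = "2 ^ (\<Sum>k<j. k + 2) :: real"
  have K: "1 \<le> ?K" by simp
  let ?X = "integral {a..b} (\<lambda>x. \<bar>D (Suc j) x\<bar>)" and ?Y = "integral {a..b} (\<lambda>x. \<bar>D 0 x\<bar>)"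
  have X0: "0 \<le> ?X" and Y0: "0 \<le> ?Y" 
    by (auto intro!: integral_nonneg integrable_continuous_real continuous_intros contD)
  have var: "\<bar>D j q - D j p\<bar> \<le> ?X" if "a \<le> p" "p \<le> q" "q \<le> b" for p q
  proof -
    have "(D (Suc j) has_integral (D j q - D j p)) {p..q}"
      using that der by (intro fundamental_theorem_of_calculus)
        (auto simp: has_real_derivative_iff_has_vector_derivative[symmetric]
          intro: has_field_derivative_at_within)
    then have "\<bar>D j q - D j p\<bar> = \<bar>integral {p..q} (D (Suc j))\<bar>" by (simp add: integral_unique)
    also have "\<dots> \<le> integral {p..q} (\<lambda>x. \<bar>D (Suc j) x\<bar>)"
      using integral_norm_bound_integral[of "D (Suc j)" "{p..q}" "\<lambda>x. \<bar>D (Suc j) x\<bar>"]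
      by (auto intro!: integrable_continuous_real continuous_intros contD)
    also have "\<dots> \<le> ?X" using that
      by (intro integral_subset_le) (auto intro!: integrable_continuous_real continuous_intros contD)
    finally show ?thesis .
  qed
  have mX: "m \<le> ?X" using var[of s t] var[of t s] s t st by (cases "s \<le> t") auto
  \<comment> \<open>The lower bound is assumed on the open interval; continuity carries it to the
    end points.\<close>
  have mj: "m \<le> \<bar>D j x\<bar>" if "x \<in> {a..b}" for x
  proof -
    have "{a..b} = closure {a<..<b}" using \<open>a < b\<close> by simp
    with that have "x \<in> closure {a<..<b}" by simp
    then show ?thesis
      by (rule continuous_ge_on_closure[rotated]) (auto intro!: continuous_intros contD m)
  qed
  have mY: "m * (b - a) ^ (j + 1) \<le> ?K * ?Y"
    using assms mj by (intro lower_bound_integral_abs_of_abs) (auto intro: contD)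
  have "integral {a..b} (\<lambda>x. l * \<bar>D (Suc j) x\<bar> + \<bar>D 0 x\<bar> / l ^ j) = l * ?X + ?Y / l ^ j"
    by (subst integral_add) (use \<open>0 < l\<close> in \<open>auto intro!: integrable_continuous_real continuous_intros contD\<close>)
  \<comment> \<open>On an interval of length at most \<open>l\<close> the term \<open>l * ?X\<close>
    suffices. On a longer one \<open>l ^ j \<le> (b - a) ^ j\<close>, and the term
    \<open>?Y / l ^ j\<close> suffices.\<close>
  moreover have "m / ?K * (b - a) \<le> l * ?X + ?Y / l ^ j"
  proof (cases "b - a \<le> l")
    case True
    have "m / ?K * (b - a) \<le> m * (b - a)" using K \<open>a < b\<close> \<open>0 < m\<close>
      by (intro mult_right_mono) (auto simp: divide_le_eq)
    also have "\<dots> \<le> ?X * l" using True mX \<open>a < b\<close> \<open>0 < m\<close> X0 by (intro mult_mono) auto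
    finally show ?thesis using Y0 \<open>0 < l\<close>
      by (smt (verit) mult.commute zero_le_divide_iff zero_less_power)
  next
    case False
    have "m * (b - a) * l ^ j \<le> m * (b - a) * (b - a) ^ j"
      using False \<open>0 < l\<close> \<open>0 < m\<close> by (intro mult_left_mono power_mono) auto
    with mY have "m * (b - a) * l ^ j \<le> ?K * ?Y" by (simp add: algebra_simps)
    then have "m / ?K * (b - a) \<le> ?Y / l ^ j"
      using \<open>0 < l\<close> by (simp add: field_simps)
    moreover have "0 \<le> l * ?X" using X0 \<open>0 < l\<close> by simp
    ultimately show ?thesis by linarith
  qed
  ultimately show ?thesis by simp
qed

section \<open>Open subsets of the line and their components\<close>

text \<open>The excluded end point \<open>a\<close> is what later forces variation on the component.
  It is outside \<open>S\<close> because otherwise \<open>{a..<b}\<close> would be a strictly larger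
  connected subset of \<open>S\<close>.\<close>

lemma component_open_bounded_real:
  fixes S :: "real set"
  assumes "open S" "bounded S" "C \<in> components S"
  obtains a b where "a < b" "C = {a<..<b}" "a \<notin> S"
proof -
  have C: "open C" "connected C" "C \<noteq> {}" "bounded C"
    using assms open_components in_components_connected in_components_nonempty
      in_components_subset bounded_subset by metis+
  define a b where "a = Inf C" and "b = Sup C"
  have bdd: "bdd_below C" "bdd_above C"
    using C by (auto simp: bounded_imp_bdd_below bounded_imp_bdd_above)
  have notmin: "a < x" "x < b" if "x \<in> C" for x
  proof -
    obtain e where e: "e > 0" "ball x e \<subseteq> C" using C(1) \<open>x \<in> C\<close> openE by blast
    then have "x - e / 2 \<in> C" "x + e / 2 \<in> C" by (auto simp: dist_real_def intro!: subsetD[OF e(2)])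
    then have "a \<le> x - e / 2" "x + e / 2 \<le> b" unfolding a_def b_def
      using bdd by (auto intro: cInf_lower cSup_upper)
    then show "a < x" "x < b" using e by auto
  qed
  have sub: "{a<..<b} \<subseteq> C"
  proof
    fix x assume "x \<in> {a<..<b}"
    then obtain p q where "p \<in> C" "p < x" "q \<in> C" "x < q"
      unfolding a_def b_def using cInf_lessD[OF C(3)] less_cSupD[OF C(3)] by force
    then show "x \<in> C" using connected_contains_Icc[OF C(2)] by fastforce
  qed
  have C_eq: "C = {a<..<b}" using sub notmin by fastforce
  have "a < b" using C_eq C(3) by auto
  have "a \<notin> S"
  proof
    assume "a \<in> S"
    have "{a..<b} \<subseteq> C"
    proof (rule components_maximal[OF assms(3)])
      show "{a..<b} \<subseteq> S" using \<open>a \<in> S\<close> in_components_subset[OF assms(3)] C_eq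
        by (force simp: less_le)
      show "C \<inter> {a..<b} \<noteq> {}" using C(3) C_eq by fastforce
    qed auto
    then show False using C_eq \<open>a < b\<close> by auto
  qed
  then show ?thesis using that C_eq \<open>a < b\<close> by blast
qed

text \<open>The components are countably many disjoint open sets, and the right side is the value at
  \<open>S\<close> of the measure with density \<open>f\<close>. Countable additivity of both
  measures reduces the claim to one component.\<close>

lemma emeasure_le_nn_integral_components:
  fixes S :: "real set" and f :: "real \<Rightarrow> ennreal"
  assumes "open S" and [measurable]: "f \<in> borel_measurable borel"
    and le: "\<And>C. C \<in> components S \<Longrightarrow> c * emeasure lborel C \<le> (\<integral>\<^sup>+x\<in>C. f x \<partial>lborel)"
  shows "c * emeasure lborel S \<le> (\<integral>\<^sup>+x\<in>S. f x \<partial>lborel)"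
proof -
  have op: "open C" if "C \<in> components S" for C using that assms(1) open_components by blast
  have count: "countable (components S)"
    using op pairwise_disjoint_components[of S]
    by (intro countable_disjoint_open_subsets) (auto simp: disjnt_def pairwise_def)
  have disj: "disjoint_family_on id (components S)"
    using pairwise_disjoint_components[of S] by (auto simp: disjoint_family_on_def pairwise_def)
  have *: "emeasure M S = (\<integral>\<^sup>+C. emeasure M C \<partial>count_space (components S))"
    if "sets M = sets borel" for M :: "real measure"
    using emeasure_UN_countable[OF _ count disj, of M] op that by (simp add: borel_open)
  have "c * emeasure lborel S = (\<integral>\<^sup>+C. c * emeasure lborel C \<partial>count_space (components S))"
    by (subst *) (auto simp: nn_integral_cmult)
  also have "\<dots> \<le> (\<integral>\<^sup>+C. emeasure (density lborel f) C \<partial>count_space (components S))"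
    using le op by (intro nn_integral_mono) (auto simp: emeasure_density borel_open)
  also have "\<dots> = emeasure (density lborel f) S" by (subst *) auto
  also have "\<dots> = (\<integral>\<^sup>+x\<in>S. f x \<partial>lborel)"
    using assms(1) by (simp add: emeasure_density borel_open)
  finally show ?thesis .
qed

text \<open>A point is in \<open>S\<close> if a segment on which \<open>\<bar>D j\<bar>\<close>
  stays in the band \<open>{m<..<16 * m}\<close> joins it to a point with value in the core
  \<open>{2 * m<..<8 * m}\<close>. Each component contains such a core point, while its left end
  point has left the band, so \<open>interval_estimate\<close> applies to it.\<close>

lemma slice_estimate:
  fixes D :: "nat \<Rightarrow> real \<Rightarrow> real"
  assumes "0 < m" "0 < l"
    and der: "\<And>k x. k \<le> j \<Longrightarrow> (D k has_real_derivative D (Suc k) x) (at x)"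
    and cont: "continuous_on UNIV (D (Suc j))"
    and S_def: "S = {r. \<exists>h. (\<forall>t\<in>{0..1}. \<bar>D j (r + t * h)\<bar> \<in> {m<..<16 * m}) \<and>
        \<bar>D j (r + h)\<bar> \<in> {2 * m<..<8 * m}}"
    and "open S" "bounded S"
  shows "ennreal (m / 2 ^ (\<Sum>k<j. k + 2)) * emeasure lborel S
    \<le> (\<integral>\<^sup>+x\<in>S. ennreal (l * \<bar>D (Suc j) x\<bar> + \<bar>D 0 x\<bar> / l ^ j) \<partial>lborel)"
proof (rule emeasure_le_nn_integral_components[OF \<open>open S\<close>])
  have cont': "continuous_on UNIV (D k)" if "k \<le> j" for k
    using that der DERIV_continuous_on has_field_derivative_at_within by metis
  have cont_f: "continuous_on UNIV (\<lambda>x. l * \<bar>D (Suc j) x\<bar> + \<bar>D 0 x\<bar> / l ^ j)"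
    using \<open>0 < l\<close> by (intro continuous_intros cont cont') auto
  then have "(\<lambda>x. l * \<bar>D (Suc j) x\<bar> + \<bar>D 0 x\<bar> / l ^ j) \<in> borel_measurable borel"
    by (rule borel_measurable_continuous_onI)
  then show "(\<lambda>x. ennreal (l * \<bar>D (Suc j) x\<bar> + \<bar>D 0 x\<bar> / l ^ j)) \<in> borel_measurable borel"
    by measurable
  fix C assume C: "C \<in> components S"
  then obtain a b where ab: "a < b" "C = {a<..<b}" "a \<notin> S"
    using component_open_bounded_real[OF \<open>open S\<close> \<open>bounded S\<close>] by metis
  have CS: "{a<..<b} \<subseteq> S" using C ab in_components_subset by metis
  have m: "m < \<bar>D j x\<bar>" "\<bar>D j x\<bar> < 16 * m" if x: "x \<in> {a<..<b}" for x
  proof -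
    obtain h where h: "\<forall>t\<in>{0..1}. \<bar>D j (x + t * h)\<bar> \<in> {m<..<16 * m}"
      using x CS S_def by blast
    show "m < \<bar>D j x\<bar>" "\<bar>D j x\<bar> < 16 * m" using bspec[OF h, of 0] by auto
  qed
  \<comment> \<open>Membership in \<open>S\<close> in terms of segments; the displacement is
    \<open>r - y\<close>.\<close>
  have seg: "y \<in> S" if "\<bar>D j r\<bar> \<in> {2 * m<..<8 * m}"
    and *: "\<And>z. z \<in> closed_segment y r \<Longrightarrow> \<bar>D j z\<bar> \<in> {m<..<16 * m}" for y r
  proof -
    have "\<bar>D j (y + t * (r - y))\<bar> \<in> {m<..<16 * m}" if t: "t \<in> {0..1}" for t
    proof (rule *)
      show "y + t * (r - y) \<in> closed_segment y r"
        unfolding in_segment using t by (intro exI[of _ t]) (auto simp: algebra_simps)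
    qed
    then show ?thesis unfolding S_def using that(1) by (intro CollectI exI[of _ "r - y"]) auto
  qed
  \<comment> \<open>Each point of the segment from \<open>y\<close> to \<open>y + h\<close> is in
    \<open>S\<close>, by the subsegment ending at \<open>y + h\<close>. The segment is connected and
    meets \<open>C\<close>, hence lies in \<open>C\<close> together with its core end point.\<close>
  obtain r where r: "r \<in> {a<..<b}" "\<bar>D j r\<bar> \<in> {2 * m<..<8 * m}"
  proof -
    obtain y where y: "y \<in> {a<..<b}" using ab(1) dense by auto
    then obtain h where h: "\<And>t. t\<in>{0..1} \<Longrightarrow> \<bar>D j (y + t * h)\<bar> \<in> {m<..<16 * m}"
      and h1: "\<bar>D j (y + h)\<bar> \<in> {2 * m<..<8 * m}" using CS S_def by blast
    have *: "\<bar>D j z\<bar> \<in> {m<..<16 * m}" if z: "z \<in> closed_segment y (y + h)" for z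
    proof -
      obtain t where "0 \<le> t" "t \<le> 1" "z = (1 - t) * y + t * (y + h)"
        using z by (auto simp: in_segment)
      then show ?thesis using h[of t] by (auto simp: algebra_simps)
    qed
    have "closed_segment y (y + h) \<subseteq> C"
    proof (rule components_maximal[OF C])
      show "closed_segment y (y + h) \<subseteq> S"
      proof
        fix z assume z: "z \<in> closed_segment y (y + h)"
        then have "closed_segment z (y + h) \<subseteq> closed_segment y (y + h)"
          by (simp add: subset_closed_segment)
        then show "z \<in> S" using seg[OF h1] * by blast
      qed
      show "C \<inter> closed_segment y (y + h) \<noteq> {}" using y ab by auto
    qed auto
    then have "y + h \<in> {a<..<b}" using ab by auto
    then show ?thesis using that h1 by blast
  qed
  \<comment> \<open>Otherwise the segment from \<open>a\<close> to \<open>r\<close> would stay in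
    the band and put \<open>a\<close> into \<open>S\<close>.\<close>
  have "\<not> \<bar>D j a\<bar> \<in> {m<..<16 * m}"
  proof
    assume "\<bar>D j a\<bar> \<in> {m<..<16 * m}"
    then have "\<bar>D j z\<bar> \<in> {m<..<16 * m}" if "z \<in> closed_segment a r" for z
      using that m[of z] r(1) by (cases "z = a") (auto simp: closed_segment_eq_real_ivl)
    then show False using seg[OF r(2)] ab(3) by blast
  qed
  \<comment> \<open>The gap to the core is at least \<open>2 * m - m\<close> from below the band and
    at least \<open>16 * m - 8 * m\<close> from above it.\<close>
  then have "m \<le> \<bar>D j r - D j a\<bar>" using r(2) by auto
  then have "m / 2 ^ (\<Sum>k<j. k + 2) * (b - a)
    \<le> integral {a..b} (\<lambda>x. l * \<bar>D (Suc j) x\<bar> + \<bar>D 0 x\<bar> / l ^ j)"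
    using assms ab r(1) m by (intro interval_estimate[where s = r and t = a]) (auto intro: less_imp_le)
  then show "ennreal (m / 2 ^ (\<Sum>k<j. k + 2)) * emeasure lborel C
      \<le> (\<integral>\<^sup>+x\<in>C. ennreal (l * \<bar>D (Suc j) x\<bar> + \<bar>D 0 x\<bar> / l ^ j) \<partial>lborel)"
    using ab \<open>0 < l\<close> \<open>0 < m\<close>
    by (subst ab(2), subst nn_integral_Ioo_eq_integral[OF cont_f])
      (auto simp: ennreal_mult[symmetric] intro!: ennreal_leI)
qed

section \<open>Topology and product measure on \<open>Rn n\<close>\<close>

lemma topspace_Rn_top [simp]: "topspace (Rn_top n) = Rn n"
  by (simp add: Rn_top_def)

lemma continuous_map_upd:
  assumes "continuous_map X (Rn_top n) f" "continuous_map X euclideanreal c" "i \<in> {1..n}"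
  shows "continuous_map X (Rn_top n) (\<lambda>z. (f z)(i := c z))"
proof -
  have "f \<in> topspace X \<rightarrow> Rn n" using assms(1) continuous_map_funspace by fastforce
  then have "(\<lambda>z. (f z)(i := c z)) \<in> topspace X \<rightarrow> extensional {1..n}"
    using \<open>i \<in> {1..n}\<close> by (auto simp: extensional_def PiE_def Pi_iff)
  then show ?thesis
    using assms unfolding Rn_top_def continuous_map_componentwise
    by (auto simp: image_subset_iff Pi_iff fun_upd_def)
qed

text \<open>Restriction to \<open>{1..n}\<close> is continuous on all of
  \<open>nat \<Rightarrow> real\<close>, where open sets are measurable for the countable product.
  Pulling back along this restriction, which is the identity on \<open>Rn n\<close>, recovers
  \<open>U\<close>.\<close>

lemma openin_Rn_top_sets:
  assumes "openin (Rn_top n) U"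
  shows "U \<in> sets (\<Pi>\<^sub>M k\<in>{1..n}. lborel)"
proof -
  let ?M = "\<Pi>\<^sub>M k\<in>{1..n}. (lborel :: real measure)"
  let ?r = "\<lambda>x :: nat \<Rightarrow> real. restrict x {1..n}"
  have "continuous_map (product_topology (\<lambda>_. euclideanreal) UNIV) (Rn_top n) ?r"
    unfolding Rn_top_def continuous_map_componentwise
    by (auto intro: continuous_map_product_projection)
  then have "continuous_map euclidean (Rn_top n) ?r"
    by (simp add: euclidean_product_topology)
  then have "open (?r -` U)"
    using openin_continuous_map_preimage[OF _ assms] by (fastforce simp: vimage_def)
  then have V: "?r -` U \<in> sets (\<Pi>\<^sub>M k\<in>UNIV. (borel :: real measure))"
    by (simp add: sets_PiM_equal_borel borel_open)
  have m: "?r \<in> ?M \<rightarrow>\<^sub>M (\<Pi>\<^sub>M k\<in>UNIV. (borel :: real measure))"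
  proof (rule measurable_PiM_single')
    fix k :: nat
    show "(\<lambda>x. ?r x k) \<in> ?M \<rightarrow>\<^sub>M borel"
      by (cases "k \<in> {1..n}") (auto simp: measurable_component_singleton)
  qed auto
  have "?r -` (?r -` U) \<inter> space ?M = U"
    using openin_subset[OF assms]
    by (auto simp: space_PiM PiE_restrict PiE_def extensional_restrict subset_iff)
  then show ?thesis using measurable_sets[OF m V] by simp
qed

lemma continuous_map_Rn_top_measurable:
  assumes "continuous_map (Rn_top n) euclideanreal f"
  shows "f \<in> borel_measurable (\<Pi>\<^sub>M k\<in>{1..n}. lborel)"
proof (rule borel_measurableI)
  fix S :: "real set" assume "open S"
  then have "openin (Rn_top n) {x \<in> Rn n. f x \<in> S}"
    using openin_continuous_map_preimage[OF assms] by simp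
  moreover have "f -` S \<inter> space (\<Pi>\<^sub>M k\<in>{1..n}. lborel) = {x \<in> Rn n. f x \<in> S}"
    by (auto simp: space_PiM)
  ultimately show "f -` S \<inter> space (\<Pi>\<^sub>M k\<in>{1..n}. lborel) \<in> sets (\<Pi>\<^sub>M k\<in>{1..n}. lborel)"
    using openin_Rn_top_sets by metis
qed

lemma emeasure_lborel_open_pos:
  fixes U :: "'a::euclidean_space set"
  assumes "open U" "U \<noteq> {}"
  shows "0 < emeasure lborel U"
proof -
  have "U \<notin> null_sets lebesgue" using open_not_negligible assms negligible_iff_null_sets by blast
  then have "emeasure lebesgue U \<noteq> 0" using assms by (auto simp: null_sets_def)
  then show ?thesis using assms by (simp add: zero_less_iff_neq_zero)
qed

interpretation lborel_PiM: product_sigma_finite "\<lambda>_. lborel :: real measure"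
  by standard

text \<open>A nonempty open set contains an open box, whose measure is a finite product of positive
  factors.\<close>

lemma emeasure_openin_pos:
  assumes "openin (Rn_top n) U" "U \<noteq> {}"
  shows "0 < emeasure (\<Pi>\<^sub>M k\<in>{1..n}. lborel) U"
proof -
  obtain x where x: "x \<in> U" using assms by blast
  then obtain V where V: "\<And>k. k \<in> {1..n} \<Longrightarrow> open (V k)"
    "x \<in> Pi\<^sub>E {1..n} V" "Pi\<^sub>E {1..n} V \<subseteq> U"
    using assms unfolding Rn_top_def openin_product_topology_alt by fastforce
  have "emeasure lborel (V k) \<noteq> 0" if "k \<in> {1..n}" for k
  proof -
    have "x k \<in> V k" using that V(2) by auto
    then show ?thesis using emeasure_lborel_open_pos[OF V(1)[OF that]]
      by (metis empty_iff less_irrefl)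
  qed
  then have "0 < emeasure (\<Pi>\<^sub>M k\<in>{1..n}. lborel) (Pi\<^sub>E {1..n} V)"
    using V(1) by (subst lborel_PiM.emeasure_PiM) (auto simp: zero_less_iff_neq_zero borel_open)
  also have "\<dots> \<le> emeasure (\<Pi>\<^sub>M k\<in>{1..n}. lborel) U"
    using V(3) openin_Rn_top_sets[OF assms(1)] by (intro emeasure_mono)
  finally show ?thesis .
qed

lemma compactin_Rn_top_bounded:
  assumes "compactin (Rn_top n) K"
  obtains R where "K \<subseteq> {1..n} \<rightarrow>\<^sub>E {-R..R}"
proof -
  have "\<forall>k\<in>{1..n}. \<exists>r. \<forall>x\<in>K. \<bar>x k\<bar> \<le> r"
  proof
    fix k assume k: "k \<in> {1..n}"
    have "continuous_map (Rn_top n) euclideanreal (\<lambda>x. x k)"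
      unfolding Rn_top_def using k by (rule continuous_map_product_projection)
    then have "compact ((\<lambda>x. x k) ` K)" using image_compactin[OF assms] by force
    then have "bounded ((\<lambda>x. x k) ` K)" by (rule compact_imp_bounded)
    then show "\<exists>r. \<forall>x\<in>K. \<bar>x k\<bar> \<le> r" by (auto simp: bounded_iff)
  qed
  then obtain r where r: "\<And>k x. k \<in> {1..n} \<Longrightarrow> x \<in> K \<Longrightarrow> \<bar>x k\<bar> \<le> r k" by metis
  \<comment> \<open>The sum of the bounds serves as one bound for all coordinates.\<close>
  have "K \<subseteq> {1..n} \<rightarrow>\<^sub>E {-(\<Sum>k=1..n. \<bar>r k\<bar>)..(\<Sum>k=1..n. \<bar>r k\<bar>)}"
  proof
    fix x assume x: "x \<in> K"
    have "\<bar>x k\<bar> \<le> (\<Sum>k=1..n. \<bar>r k\<bar>)" if "k \<in> {1..n}" for k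
      using r[OF that x] member_le_sum[of k "{1..n}" "\<lambda>k. \<bar>r k\<bar>"] that by force
    moreover have "x \<in> Rn n" using compactin_subset_topspace[OF assms] x by auto
    ultimately show "x \<in> {1..n} \<rightarrow>\<^sub>E {-(\<Sum>k=1..n. \<bar>r k\<bar>)..(\<Sum>k=1..n. \<bar>r k\<bar>)}"
      by (auto simp: PiE_def Pi_iff abs_le_iff) (smt (verit) atLeastAtMost_iff)+
  qed
  then show ?thesis by (rule that)
qed

lemma emeasure_subset_compactin_finite:
  assumes "compactin (Rn_top n) K" "A \<subseteq> K"
  shows "emeasure (\<Pi>\<^sub>M k\<in>{1..n}. lborel) A < \<infinity>"
proof -
  obtain R where R: "K \<subseteq> {1..n} \<rightarrow>\<^sub>E {-R..R}" using compactin_Rn_top_bounded[OF assms(1)] .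
  have "emeasure (\<Pi>\<^sub>M k\<in>{1..n}. lborel) A
      \<le> emeasure (\<Pi>\<^sub>M k\<in>{1..n}. lborel) ({1..n} \<rightarrow>\<^sub>E {-R..R})"
    using R assms(2) by (intro emeasure_mono sets_PiM_I_finite) auto
  also have "\<dots> = (\<Prod>k=1..n. emeasure lborel {-R..R})"
    by (rule lborel_PiM.emeasure_PiM) auto
  also have "\<dots> < \<infinity>" by (simp add: emeasure_lborel_Icc_eq ennreal_power)
  finally show ?thesis .
qed

section \<open>Iterated partial derivatives and their supports\<close>

lemma Ck_continuous_map: "Ck n m u \<Longrightarrow> continuous_map (Rn_top n) euclideanreal u"
  by (cases m) auto

lemma Ck_funpow_partial_deriv:
  assumes "Ck n (k + m) u" "i \<in> {1..n}"
  shows "Ck n m ((partial_deriv i ^^ k) u)"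
  using assms(1)
proof (induction k arbitrary: u)
  case (Suc k)
  then have "Ck n (k + m) (partial_deriv i u)" using assms(2) by simp
  then show ?case using Suc.IH by (simp only: funpow_Suc_right comp_apply)
qed simp

text \<open>\<open>Ck\<close> speaks of the slice through a point at that point's own coordinate;
  moving the base point to \<open>x(i := t)\<close> gives the derivative at every
  \<open>t\<close>.\<close>

lemma partial_deriv_slice:
  assumes "Ck n (Suc m) u" "i \<in> {1..n}" "x \<in> Rn n"
  shows "((\<lambda>t. u (x(i := t))) has_real_derivative partial_deriv i u (x(i := t))) (at t)"
proof -
  let ?y = "x(i := t)"
  have y: "?y \<in> Rn n" using assms(2,3) by (auto simp: PiE_def extensional_def)
  have "\<forall>i\<in>{1..n}. \<forall>x\<in>Rn n. (\<lambda>t. u (x(i := t))) differentiable (at (x i))"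
    using assms(1) by simp
  then have "(\<lambda>s. u (?y(i := s))) differentiable (at (?y i))"
    using assms(2) y by blast
  then have "(\<lambda>s. u (x(i := s))) differentiable (at t)" by simp
  then have "((\<lambda>s. u (x(i := s))) has_real_derivative deriv (\<lambda>s. u (x(i := s))) t) (at t)"
    by (simp add: DERIV_deriv_iff_real_differentiable)
  then show ?thesis by (simp add: partial_deriv_def)
qed

text \<open>The complement of \<open>K\<close> is open, so on the line through \<open>x\<close> the
  function \<open>u\<close> vanishes near \<open>x i\<close>.\<close>

lemma support_partial_deriv:
  assumes K: "closedin (Rn_top n) K" and i: "i \<in> {1..n}"
    and u: "\<And>x. x \<in> Rn n - K \<Longrightarrow> u x = 0" and x: "x \<in> Rn n - K"
  shows "partial_deriv i u x = 0"
proof -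
  have "continuous_map euclideanreal (Rn_top n) (\<lambda>t. x(i := t))"
    using x by (intro continuous_map_upd i) auto
  moreover have "openin (Rn_top n) (Rn n - K)" using K by (simp add: closedin_def)
  ultimately have "openin euclideanreal {t \<in> topspace euclideanreal. x(i := t) \<in> Rn n - K}"
    by (rule openin_continuous_map_preimage)
  then have "open {t. x(i := t) \<in> Rn n - K}" by simp
  moreover have "x i \<in> {t. x(i := t) \<in> Rn n - K}" using x by simp
  ultimately have "eventually (\<lambda>t. t \<in> {t. x(i := t) \<in> Rn n - K}) (nhds (x i))"
    by (rule eventually_nhds_in_open)
  then have "eventually (\<lambda>t. u (x(i := t)) = 0) (nhds (x i))"
    by eventually_elim (use u in auto)
  then have "deriv (\<lambda>t. u (x(i := t))) (x i) = deriv (\<lambda>t. 0) (x i)"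
    by (intro deriv_cong_ev) auto
  then show ?thesis by (simp add: partial_deriv_def)
qed

lemma support_funpow_partial_deriv:
  assumes "closedin (Rn_top n) K" "i \<in> {1..n}" "\<And>x. x \<in> Rn n - K \<Longrightarrow> u x = 0"
    and "x \<in> Rn n - K"
  shows "(partial_deriv i ^^ k) u x = 0"
  using assms(4)
proof (induction k arbitrary: x)
  case (Suc k)
  then show ?case using support_partial_deriv[OF assms(1,2)] by simp
qed (use assms(3) in simp)

section \<open>Band sets: openness and integral estimate\<close>

text \<open>
  A set \<open>{m < \<bar>g\<bar> < 16 m}\<close> alone would not do: on a component of a slice that does not meet
  \<open>{2 m < \<bar>g\<bar> < 8 m}\<close> the function \<open>g\<close> may have arbitrarily small variation.
\<close>

definition band_set :: "nat \<Rightarrow> nat \<Rightarrow> ((nat \<Rightarrow> real) \<Rightarrow> real) \<Rightarrow> real \<Rightarrow> (nat \<Rightarrow> real) set" where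
  "band_set n i g m = {x \<in> Rn n. \<exists>h.
     (\<forall>t\<in>{0..1}. \<bar>g (x(i := x i + t * h))\<bar> \<in> {m<..<16 * m}) \<and>
     \<bar>g (x(i := x i + h))\<bar> \<in> {2 * m<..<8 * m}}"

lemma band_set_bounds:
  assumes "x \<in> band_set n i g m"
  shows "\<bar>g x\<bar> \<in> {m<..<16 * m}"
proof -
  obtain h where "\<forall>t\<in>{0..1}. \<bar>g (x(i := x i + t * h))\<bar> \<in> {m<..<16 * m}"
    using assms unfolding band_set_def by blast
  from bspec[OF this, of 0] show ?thesis by simp
qed

lemma in_band_set:
  assumes "x \<in> Rn n" "\<bar>g x\<bar> \<in> {2 * m<..<8 * m}"
  shows "x \<in> band_set n i g m"
  unfolding band_set_def using assms by (intro CollectI conjI exI[of _ 0]) auto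

text \<open>The displacement \<open>h\<close> of one point works for its neighbours: the condition
  at the end of the segment is open, and the one along the segment is open by the tube lemma, as
  \<open>t\<close> ranges over the compact \<open>{0..1}\<close>.\<close>

lemma openin_band_set:
  assumes g: "continuous_map (Rn_top n) euclideanreal g" and i: "i \<in> {1..n}"
  shows "openin (Rn_top n) (band_set n i g m)"
proof (subst openin_subopen, intro ballI)
  fix x assume x: "x \<in> band_set n i g m"
  then obtain h where h: "\<And>t. t \<in> {0..1} \<Longrightarrow> \<bar>g (x(i := x i + t * h))\<bar> \<in> {m<..<16 * m}"
    and h1: "\<bar>g (x(i := x i + h))\<bar> \<in> {2 * m<..<8 * m}" and xn: "x \<in> Rn n"
    unfolding band_set_def by blast
  have proj: "continuous_map (Rn_top n) euclideanreal (\<lambda>x. x i)"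
    unfolding Rn_top_def using i by (rule continuous_map_product_projection)
  let ?Z = "prod_topology (Rn_top n) euclideanreal"
  have "continuous_map ?Z euclideanreal (\<lambda>z. fst z i)"
    using continuous_map_compose[OF continuous_map_fst proj] by (simp add: comp_def)
  then have "continuous_map ?Z (Rn_top n) (\<lambda>z. (fst z)(i := fst z i + snd z * h))"
    by (intro continuous_map_upd i continuous_map_fst continuous_map_add
        continuous_map_real_mult continuous_map_snd continuous_map_canonical_const) auto
  from continuous_map_compose[OF this g]
  have c: "continuous_map ?Z euclideanreal (\<lambda>z. \<bar>g ((fst z)(i := fst z i + snd z * h))\<bar>)"
    by (auto simp: comp_def intro: continuous_map_real_abs)
  define W where "W = {z \<in> topspace ?Z. \<bar>g ((fst z)(i := fst z i + snd z * h))\<bar> \<in> {m<..<16 * m}}"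
  have W: "openin ?Z W"
    unfolding W_def by (rule openin_continuous_map_preimage[OF c]) auto
  have "{x} \<times> {0..1} \<subseteq> W" unfolding W_def using xn h by auto
  then obtain U V where U: "openin (Rn_top n) U" "x \<in> U" and "{0..1} \<subseteq> V" "U \<times> V \<subseteq> W"
    using tube_lemma_right[OF W, of "{0..1}" x] xn by auto
  then have UW: "\<bar>g (y(i := y i + t * h))\<bar> \<in> {m<..<16 * m}" if "y \<in> U" "t \<in> {0..1}" for y t
    using that unfolding W_def by force
  define U' where "U' = {y \<in> topspace (Rn_top n). \<bar>g (y(i := y i + h))\<bar> \<in> {2 * m<..<8 * m}}"
  have "continuous_map (Rn_top n) (Rn_top n) (\<lambda>y. y(i := y i + h))"
    by (intro continuous_map_upd i continuous_map_add proj) auto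
  from continuous_map_compose[OF this g]
  have c: "continuous_map (Rn_top n) euclideanreal (\<lambda>y. \<bar>g (y(i := y i + h))\<bar>)"
    by (auto simp: comp_def intro: continuous_map_real_abs)
  have "openin (Rn_top n) U'"
    unfolding U'_def by (rule openin_continuous_map_preimage[OF c]) auto
  then have "openin (Rn_top n) (U \<inter> U')" using U by blast
  moreover have "x \<in> U \<inter> U'" using U h1 xn by (auto simp: U'_def)
  moreover have "U \<inter> U' \<subseteq> band_set n i g m"
    using UW unfolding U'_def band_set_def by (fastforce intro!: exI[of _ h])
  ultimately show "\<exists>T. openin (Rn_top n) T \<and> x \<in> T \<and> T \<subseteq> band_set n i g m" by blast
qed

text \<open>Integrating over coordinate \<open>i\<close> first, \<open>slice_estimate\<close>
  applies on each line in direction \<open>i\<close>. Its bound is linear in the measure of the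
  slice, so integration over the other coordinates keeps the constant, which is thus independent of
  \<open>n\<close>.\<close>

lemma band_set_estimate:
  assumes u: "Ck n (j + 1) u" and i: "i \<in> {1..n}" and "0 < m" "0 < l"
    and K: "compactin (Rn_top n) K" "band_set n i ((partial_deriv i ^^ j) u) m \<subseteq> K"
  defines "A \<equiv> band_set n i ((partial_deriv i ^^ j) u) m"
  shows "ennreal (m / 2 ^ (\<Sum>k<j. k + 2)) * emeasure (\<Pi>\<^sub>M k\<in>{1..n}. lborel) A
    \<le> (\<integral>\<^sup>+x\<in>A. ennreal (l * \<bar>(partial_deriv i ^^ (j + 1)) u x\<bar> + \<bar>u x\<bar> / l ^ j)
          \<partial>(\<Pi>\<^sub>M k\<in>{1..n}. lborel))"
proof -
  let ?M = "\<Pi>\<^sub>M k\<in>{1..n}. (lborel :: real measure)"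
  let ?I = "{1..n} - {i}"
  let ?c = "m / 2 ^ (\<Sum>k<j. k + 2)"
  let ?F = "\<lambda>x. ennreal (l * \<bar>(partial_deriv i ^^ (j + 1)) u x\<bar> + \<bar>u x\<bar> / l ^ j)"
  have I: "insert i ?I = {1..n}" using i by auto
  have Ck: "Ck n (j + 1 - k) ((partial_deriv i ^^ k) u)" if "k \<le> j + 1" for k
    using Ck_funpow_partial_deriv[of n k "j + 1 - k" u i] u i that by simp
  have cont: "continuous_map (Rn_top n) euclideanreal ((partial_deriv i ^^ k) u)" if "k \<le> j + 1" for k
    using Ck[OF that] by (rule Ck_continuous_map)
  have opA: "openin (Rn_top n) A"
    unfolding A_def using cont[of j] i by (intro openin_band_set) auto
  then have [measurable]: "A \<in> sets ?M" by (rule openin_Rn_top_sets)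
  have [measurable]: "(partial_deriv i ^^ (j + 1)) u \<in> borel_measurable ?M"
    "u \<in> borel_measurable ?M"
    using continuous_map_Rn_top_measurable cont[of "j + 1"] Ck_continuous_map[OF u] by blast+
  have F: "?F \<in> borel_measurable ?M" by measurable
  have fub: "(\<integral>\<^sup>+x. f x \<partial>?M)
      = (\<integral>\<^sup>+x. (\<integral>\<^sup>+t. f (x(i := t)) \<partial>lborel) \<partial>(\<Pi>\<^sub>M k\<in>?I. lborel))"
    if "f \<in> borel_measurable ?M" for f
    using lborel_PiM.product_nn_integral_insert[of ?I i f] that I by simp
  obtain R where R: "K \<subseteq> {1..n} \<rightarrow>\<^sub>E {-R..R}" using compactin_Rn_top_bounded[OF K(1)] .
  have "ennreal ?c * emeasure ?M A = (\<integral>\<^sup>+x. ennreal ?c * indicator A x \<partial>?M)"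
    by (rule nn_integral_cmult_indicator[symmetric]) measurable
  also have "\<dots> = (\<integral>\<^sup>+x. (\<integral>\<^sup>+t. ennreal ?c * indicator A (x(i := t)) \<partial>lborel) \<partial>(\<Pi>\<^sub>M k\<in>?I. lborel))"
    by (rule fub) measurable
  also have "\<dots> \<le> (\<integral>\<^sup>+x. (\<integral>\<^sup>+t. ?F (x(i := t)) * indicator A (x(i := t)) \<partial>lborel)
      \<partial>(\<Pi>\<^sub>M k\<in>?I. lborel))"
  proof (rule nn_integral_mono)
    fix x assume "x \<in> space (\<Pi>\<^sub>M k\<in>?I. (lborel :: real measure))"
    \<comment> \<open>The Fubini variable \<open>x\<close> is \<open>undefined\<close> at
      \<open>i\<close>; the value 0 there makes it a point of \<open>Rn n\<close> without changing
      any \<open>x(i := t)\<close>.\<close>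
    define x0 where "x0 = x(i := 0)"
    have upd: "x(i := t) = x0(i := t)" for t by (simp add: x0_def)
    have x0: "x0 \<in> Rn n"
      using \<open>x \<in> _\<close> i by (auto simp: x0_def space_PiM PiE_def extensional_def)
    then have x0t: "x0(i := t) \<in> Rn n" for t using i by (auto simp: PiE_def extensional_def)
    define S where "S = {t. x0(i := t) \<in> A}"
    have c0: "continuous_map euclideanreal (Rn_top n) (\<lambda>t. x0(i := t))"
      using x0 by (intro continuous_map_upd i) auto
    have "open S"
      using openin_continuous_map_preimage[OF c0 opA] by (simp add: S_def)
    have "S \<subseteq> {-R..R}"
    proof
      fix t assume "t \<in> S"
      then have "x0(i := t) \<in> {1..n} \<rightarrow>\<^sub>E {-R..R}"
        using K(2) R unfolding S_def A_def by blast
      from PiE_mem[OF this i] show "t \<in> {-R..R}" by simp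
    qed
    then have "bounded S" using bounded_closed_interval bounded_subset by blast
    have "ennreal ?c * emeasure lborel S
      \<le> (\<integral>\<^sup>+t\<in>S. ennreal (l * \<bar>(partial_deriv i ^^ (Suc j)) u (x0(i := t))\<bar>
            + \<bar>(partial_deriv i ^^ 0) u (x0(i := t))\<bar> / l ^ j) \<partial>lborel)"
    proof (rule slice_estimate[where D = "\<lambda>k t. (partial_deriv i ^^ k) u (x0(i := t))"])
      fix k t assume "k \<le> j"
      then show "((\<lambda>t. (partial_deriv i ^^ k) u (x0(i := t))) has_real_derivative
          (partial_deriv i ^^ Suc k) u (x0(i := t))) (at t)"
        using partial_deriv_slice[of n "j - k" "(partial_deriv i ^^ k) u" i x0 t] Ck[of k] i x0
        by (simp add: Suc_diff_le)
    next
      show "continuous_on UNIV (\<lambda>t. (partial_deriv i ^^ Suc j) u (x0(i := t)))"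
        using continuous_map_compose[OF c0 cont[of "Suc j"]] by (simp add: comp_def)
    next
      show "S = {r. \<exists>h. (\<forall>t\<in>{0..1}. \<bar>(partial_deriv i ^^ j) u (x0(i := r + t * h))\<bar> \<in> {m<..<16 * m}) \<and>
        \<bar>(partial_deriv i ^^ j) u (x0(i := r + h))\<bar> \<in> {2 * m<..<8 * m}}"
        unfolding S_def A_def band_set_def using x0t by simp
    qed fact+
    moreover have "ennreal ?c * emeasure lborel S
        = (\<integral>\<^sup>+t. ennreal ?c * indicator A (x(i := t)) \<partial>lborel)"
    proof -
      have "indicator A (x(i := t)) = (indicator S t :: ennreal)" for t
        by (simp add: S_def upd indicator_def)
      then show ?thesis using \<open>open S\<close> by (simp add: nn_integral_cmult)
    qed
    moreover have "(\<integral>\<^sup>+t\<in>S. ennreal (l * \<bar>(partial_deriv i ^^ (Suc j)) u (x0(i := t))\<bar>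
            + \<bar>(partial_deriv i ^^ 0) u (x0(i := t))\<bar> / l ^ j) \<partial>lborel)
        = (\<integral>\<^sup>+t. ?F (x(i := t)) * indicator A (x(i := t)) \<partial>lborel)"
      by (intro nn_integral_cong) (simp add: S_def upd indicator_def)
    ultimately show "(\<integral>\<^sup>+t. ennreal ?c * indicator A (x(i := t)) \<partial>lborel)
        \<le> (\<integral>\<^sup>+t. ?F (x(i := t)) * indicator A (x(i := t)) \<partial>lborel)"
      by simp
  qed
  also have "\<dots> = (\<integral>\<^sup>+x\<in>A. ?F x \<partial>?M)"
    by (rule fub[symmetric]) (use F in measurable)
  finally show ?thesis .
qed

section \<open>From integrals to averages\<close>

text \<open>Trades a bound at every scale \<open>l\<close> for a product of powers. If
  \<open>X\<close> or \<open>Y\<close> is 0, the right side is 0, and \<open>K \<le> 0\<close> has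
  to be shown.\<close>

lemma le_of_forall_scale:
  fixes X Y K :: real
  assumes "0 \<le> X" "0 \<le> Y" "1 \<le> j" and le: "\<And>l. 0 < l \<Longrightarrow> K \<le> l * X + Y / l ^ j"
  shows "K \<le> 2 * (X powr (real j / real (j + 1)) * Y powr (1 / real (j + 1)))"
proof (cases "X = 0 \<or> Y = 0")
  case True
  \<comment> \<open>let \<open>l\<close> tend to \<open>\<infinity>\<close> or to \<open>0\<close>\<close>
  then have "K \<le> 0"
  proof
    assume "X = 0"
    have "((\<lambda>l. Y * inverse (l ^ j)) \<longlongrightarrow> Y * 0) at_top"
      using \<open>1 \<le> j\<close> by (intro tendsto_intros tendsto_inverse_0_at_top filterlim_pow_at_top filterlim_ident) auto
    moreover have "eventually (\<lambda>l. K \<le> Y * inverse (l ^ j)) at_top"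
      using eventually_gt_at_top[of 0] by eventually_elim (use le \<open>X = 0\<close> in \<open>simp add: field_simps\<close>)
    ultimately show ?thesis using tendsto_lowerbound by fastforce
  next
    assume "Y = 0"
    have "((\<lambda>l. l * X) \<longlongrightarrow> 0 * X) (at_right 0)" by (intro tendsto_intros)
    moreover have "eventually (\<lambda>l. K \<le> l * X) (at_right 0)"
      using eventually_at_right_less[of 0] by eventually_elim (use le \<open>Y = 0\<close> in simp)
    ultimately show ?thesis using tendsto_lowerbound by fastforce
  qed
  also have "0 \<le> 2 * (X powr (real j / real (j + 1)) * Y powr (1 / real (j + 1)))" by simp
  finally show ?thesis .
next
  case False
  then have pos: "0 < X" "0 < Y" using assms by auto
  define a where "a = 1 / (real j + 1)"
  have ja: "j * a = 1 - a" by (auto simp: a_def field_simps)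
  \<comment> \<open>At this scale the two terms coincide, both being
    \<open>X powr (1 - a) * Y powr a\<close>; hence the factor 2.\<close>
  define l where "l = (Y / X) powr a"
  have "l * X = X powr (1 - a) * Y powr a"
    using pos by (simp add: l_def powr_divide powr_diff)
  moreover have "Y / l ^ j = X powr (1 - a) * Y powr a"
  proof -
    have "l ^ j = (Y / X) powr (1 - a)"
      using pos by (simp add: l_def powr_realpow[symmetric] powr_powr ja mult.commute[of a])
    then show ?thesis using pos by (simp add: powr_divide powr_diff)
  qed
  moreover have "0 < l" using pos by (simp add: l_def)
  ultimately have "K \<le> 2 * (X powr (1 - a) * Y powr a)" using le[of l] by (simp add: mult_ac)
  moreover have "real j / real (j + 1) = 1 - a" "1 / real (j + 1) = a"
    by (auto simp: a_def field_simps)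
  ultimately show ?thesis by simp
qed

definition average :: "'a measure \<Rightarrow> ('a \<Rightarrow> real) \<Rightarrow> 'a set \<Rightarrow> ennreal" where
  "average M f A = 1 / emeasure M A * (\<integral>\<^sup>+s\<in>A. ennreal \<bar>f s\<bar> \<partial>M)"

lemma infsum_indicator_finite:
  fixes f :: "'a set \<Rightarrow> ennreal"
  assumes "finite {A \<in> S. x \<in> A}"
  shows "(\<Sum>\<^sub>\<infinity>A\<in>S. indicator A x * f A) = (\<Sum>A | A \<in> S \<and> x \<in> A. f A)"
proof -
  have "(\<Sum>\<^sub>\<infinity>A\<in>S. indicator A x * f A) = (\<Sum>\<^sub>\<infinity>A\<in>{A \<in> S. x \<in> A}. f A)"
    by (rule infsum_cong_neutral) auto
  then show ?thesis using assms by simp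
qed

text \<open>Finiteness is essential: \<open>enn2real\<close> sends \<open>\<infinity>\<close> to 0,
  so it is monotone only below a finite upper value.\<close>

lemma average_le_averaging_op:
  assumes fin: "finite {A \<in> S. x \<in> A}" and avg: "\<And>A. A \<in> S \<Longrightarrow> average M f A < \<infinity>"
    and A: "A \<in> S" "x \<in> A"
  shows "enn2real (average M f A) \<le> enn2real (averaging_op M S f x)"
proof -
  have eq: "averaging_op M S f x = (\<Sum>A | A \<in> S \<and> x \<in> A. average M f A)"
    unfolding averaging_op_def average_def by (rule infsum_indicator_finite[OF fin])
  show ?thesis
  proof (rule enn2real_mono)
    show "average M f A \<le> averaging_op M S f x"
      unfolding eq using A fin by (intro member_le_sum) auto
    show "averaging_op M S f x < top"
      unfolding eq using avg fin by simp
  qed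
qed

lemma continuous_map_bounded_support:
  assumes f: "continuous_map (Rn_top n) euclideanreal f" and K: "compactin (Rn_top n) K"
    and 0: "\<And>x. x \<in> Rn n - K \<Longrightarrow> f x = 0"
  obtains B where "0 \<le> B" "\<And>x. x \<in> Rn n \<Longrightarrow> \<bar>f x\<bar> \<le> B"
proof -
  have "compact (f ` K)" using image_compactin[OF K f] by simp
  then obtain B where B: "\<And>x. x \<in> K \<Longrightarrow> \<bar>f x\<bar> \<le> B"
    using compact_imp_bounded bounded_iff by (metis imageI real_norm_def)
  have "\<bar>f x\<bar> \<le> max B 0" if "x \<in> Rn n" for x
    using B[of x] 0[of x] that by (cases "x \<in> K") auto
  then show ?thesis using that[of "max B 0"] by simp
qed

text \<open>Band sets are open, hence measurable before completion; their measures can be computed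
  in the plain product.\<close>

lemma Rn_lebesgue_PiM:
  assumes "A \<in> sets (\<Pi>\<^sub>M k\<in>{1..n}. lborel)"
  shows "A \<in> sets (Rn_lebesgue n)"
    "emeasure (Rn_lebesgue n) A = emeasure (\<Pi>\<^sub>M k\<in>{1..n}. lborel) A"
  unfolding Rn_lebesgue_def using assms
  by (rule sets_completionI_sets, simp only: emeasure_completion[OF sets_completionI_sets[OF assms]] main_part)

text \<open>\<open>A\<close> is open, nonempty and contained in \<open>K\<close>, so its measure is
  positive and finite. Dividing \<open>band_set_estimate\<close> by it yields, for every
  \<open>l\<close>, a bound by averages to which \<open>le_of_forall_scale\<close> applies.\<close>

lemma band_set_average:
  assumes u: "Ck n (j + 1) u" and i: "i \<in> {1..n}" and "0 < m" "1 \<le> j"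
    and K: "compactin (Rn_top n) K" "closedin (Rn_top n) K" "\<And>x. x \<in> Rn n - K \<Longrightarrow> u x = 0"
  defines "A \<equiv> band_set n i ((partial_deriv i ^^ j) u) m"
  assumes ne: "A \<noteq> {}"
  shows "A \<in> sets (Rn_lebesgue n)" "0 < emeasure (Rn_lebesgue n) A" "emeasure (Rn_lebesgue n) A < \<infinity>"
    and "average (Rn_lebesgue n) ((partial_deriv i ^^ (j + 1)) u) A < \<infinity>"
    and "average (Rn_lebesgue n) u A < \<infinity>"
    and "m / 2 ^ (\<Sum>k<j. k + 2) \<le> 2 *
      (enn2real (average (Rn_lebesgue n) ((partial_deriv i ^^ (j + 1)) u) A) powr (real j / real (j + 1))
       * enn2real (average (Rn_lebesgue n) u A) powr (1 / real (j + 1)))"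
proof -
  let ?M = "\<Pi>\<^sub>M k\<in>{1..n}. (lborel :: real measure)"
  let ?d = "(partial_deriv i ^^ (j + 1)) u"
  have cont: "continuous_map (Rn_top n) euclideanreal ((partial_deriv i ^^ k) u)" if "k \<le> j + 1" for k
  proof (rule Ck_continuous_map)
    show "Ck n (j + 1 - k) ((partial_deriv i ^^ k) u)"
      using Ck_funpow_partial_deriv[of n k "j + 1 - k" u i] u i that by simp
  qed
  have supp: "(partial_deriv i ^^ k) u x = 0" if "x \<in> Rn n - K" for k x
    by (rule support_funpow_partial_deriv[OF K(2) i K(3) that])
  have opA: "openin (Rn_top n) A"
    unfolding A_def using cont[of j] i by (intro openin_band_set) auto
  then have A[measurable]: "A \<in> sets ?M" by (rule openin_Rn_top_sets)
  \<comment> \<open>Off \<open>K\<close> the \<open>j\<close>-th derivative vanishes, whereas its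
    modulus exceeds \<open>m > 0\<close> on \<open>A\<close>.\<close>
  have AK: "A \<subseteq> K"
  proof
    fix x assume "x \<in> A"
    then show "x \<in> K"
      using band_set_bounds[of x n i _ m] supp[of x j] \<open>0 < m\<close> by (fastforce simp: A_def band_set_def)
  qed
  note leb = Rn_lebesgue_PiM[OF A]
  show "A \<in> sets (Rn_lebesgue n)" by (rule leb)
  show pos: "0 < emeasure (Rn_lebesgue n) A" using emeasure_openin_pos[OF opA ne] leb by simp
  show fin: "emeasure (Rn_lebesgue n) A < \<infinity>"
    using emeasure_subset_compactin_finite[OF K(1) AK] leb by simp
  define \<mu> where "\<mu> = measure ?M A"
  have \<mu>: "emeasure ?M A = ennreal \<mu>"
    using fin leb by (simp add: \<mu>_def emeasure_eq_ennreal_measure less_top)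
  then have \<mu>0: "0 < \<mu>" using pos leb by simp
  \<comment> \<open>A continuous function supported in \<open>K\<close> is bounded, so its integral
    over \<open>A\<close> is a real number and the passage from \<open>ennreal\<close> to
    \<open>real\<close> loses nothing.\<close>
  have *: "\<exists>r\<ge>0. (\<integral>\<^sup>+x\<in>A. ennreal \<bar>f x\<bar> \<partial>?M) = ennreal r \<and>
      average (Rn_lebesgue n) f A = ennreal (r / \<mu>)"
    if f: "continuous_map (Rn_top n) euclideanreal f" "\<And>x. x \<in> Rn n - K \<Longrightarrow> f x = 0" for f
  proof -
    obtain B where B: "0 \<le> B" "\<And>x. x \<in> Rn n \<Longrightarrow> \<bar>f x\<bar> \<le> B"
      using continuous_map_bounded_support[OF f(1) K(1) f(2)] by blast
    have "(\<integral>\<^sup>+x\<in>A. ennreal \<bar>f x\<bar> \<partial>?M) \<le> (\<integral>\<^sup>+x\<in>A. ennreal B \<partial>?M)"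
      using B by (intro nn_integral_mono) (auto simp: space_PiM indicator_def intro: ennreal_leI)
    also have "\<dots> = ennreal (B * \<mu>)"
      using B \<mu>0 unfolding nn_integral_cmult_indicator[OF A] \<mu> by (simp add: ennreal_mult)
    finally have "(\<integral>\<^sup>+x\<in>A. ennreal \<bar>f x\<bar> \<partial>?M) < top" using le_less_trans ennreal_less_top by blast
    then obtain r where r: "0 \<le> r" "(\<integral>\<^sup>+x\<in>A. ennreal \<bar>f x\<bar> \<partial>?M) = ennreal r"
      by (cases "\<integral>\<^sup>+x\<in>A. ennreal \<bar>f x\<bar> \<partial>?M") auto
    have "average (Rn_lebesgue n) f A = 1 / emeasure ?M A * (\<integral>\<^sup>+x\<in>A. ennreal \<bar>f x\<bar> \<partial>?M)"
      unfolding average_def leb(2) by (simp add: Rn_lebesgue_def nn_integral_completion)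
    also have "\<dots> = ennreal (1 / \<mu>) * ennreal r"
      unfolding \<mu> r(2) using \<mu>0 divide_ennreal[of 1 \<mu>] by simp
    also have "\<dots> = ennreal (r / \<mu>)" using \<mu>0 r by (simp add: ennreal_mult[symmetric])
    finally show ?thesis using r by blast
  qed
  obtain p where p: "0 \<le> p" "(\<integral>\<^sup>+x\<in>A. ennreal \<bar>?d x\<bar> \<partial>?M) = ennreal p"
    "average (Rn_lebesgue n) ?d A = ennreal (p / \<mu>)"
    using *[OF cont[of "j + 1"] supp] by blast
  obtain q where q: "0 \<le> q" "(\<integral>\<^sup>+x\<in>A. ennreal \<bar>u x\<bar> \<partial>?M) = ennreal q"
    "average (Rn_lebesgue n) u A = ennreal (q / \<mu>)"
    using *[OF Ck_continuous_map[OF u] K(3)] by blast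
  show "average (Rn_lebesgue n) ?d A < \<infinity>" "average (Rn_lebesgue n) u A < \<infinity>"
    using p q by auto
  have [measurable]: "?d \<in> borel_measurable ?M" "u \<in> borel_measurable ?M"
    using continuous_map_Rn_top_measurable cont[of "j + 1"] Ck_continuous_map[OF u] by blast+
  have "m / 2 ^ (\<Sum>k<j. k + 2)
      \<le> 2 * ((p / \<mu>) powr (real j / real (j + 1)) * (q / \<mu>) powr (1 / real (j + 1)))"
  proof (rule le_of_forall_scale)
    fix l :: real assume l: "0 < l"
    have "ennreal (m / 2 ^ (\<Sum>k<j. k + 2)) * emeasure ?M A
        \<le> (\<integral>\<^sup>+x\<in>A. ennreal (l * \<bar>?d x\<bar> + \<bar>u x\<bar> / l ^ j) \<partial>?M)"
      using band_set_estimate[OF u i \<open>0 < m\<close> l K(1)] AK unfolding A_def by blast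
    also have "\<dots> = (\<integral>\<^sup>+x. ennreal l * (ennreal \<bar>?d x\<bar> * indicator A x)
        + ennreal (1 / l ^ j) * (ennreal \<bar>u x\<bar> * indicator A x) \<partial>?M)"
      using l by (intro nn_integral_cong)
        (auto simp: indicator_def ennreal_mult[symmetric] ennreal_plus[symmetric] simp del: ennreal_plus)
    also have "\<dots> = ennreal l * (\<integral>\<^sup>+x\<in>A. ennreal \<bar>?d x\<bar> \<partial>?M)
        + ennreal (1 / l ^ j) * (\<integral>\<^sup>+x\<in>A. ennreal \<bar>u x\<bar> \<partial>?M)"
      by (subst nn_integral_add, measurable, subst (1 2) nn_integral_cmult, measurable)
    also have "\<dots> = ennreal (l * p + q / l ^ j)"
      unfolding p(2) q(2) using l p q by (simp add: ennreal_mult[symmetric] ennreal_plus[symmetric] del: ennreal_plus)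
    finally have "m / 2 ^ (\<Sum>k<j. k + 2) * \<mu> \<le> l * p + q / l ^ j"
      using l p(1) q(1) \<mu>0 \<open>0 < m\<close> unfolding \<mu>
      by (subst (asm) ennreal_mult[symmetric]) (auto simp del: ennreal_plus)
    then show "m / 2 ^ (\<Sum>k<j. k + 2) \<le> l * (p / \<mu>) + q / \<mu> / l ^ j"
      using \<mu>0 l by (simp add: field_simps)
  qed (use p q \<mu>0 \<open>1 \<le> j\<close> in auto)
  then show "m / 2 ^ (\<Sum>k<j. k + 2) \<le> 2 *
      (enn2real (average (Rn_lebesgue n) ?d A) powr (real j / real (j + 1))
       * enn2real (average (Rn_lebesgue n) u A) powr (1 / real (j + 1)))"
    using p q \<mu>0 by (simp add: enn2real_ennreal)
qed

section \<open>The dyadic family and the pointwise inequality\<close>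

text \<open>The empty set is removed because members must have positive measure.\<close>

definition bands :: "nat \<Rightarrow> nat \<Rightarrow> ((nat \<Rightarrow> real) \<Rightarrow> real) \<Rightarrow> (nat \<Rightarrow> real) set set" where
  "bands n i g = range (\<lambda>k::int. band_set n i g (2 powr k)) - {{}}"

text \<open>A member at level \<open>k\<close> that contains \<open>x\<close> satisfies
  \<open>k < log 2 \<bar>g x\<bar> < k + 4\<close>, which leaves at most four integers.\<close>

lemma bands_overlap:
  "finite {A \<in> bands n i g. x \<in> A}" "card {A \<in> bands n i g. x \<in> A} \<le> 4"
proof -
  define L where "L = \<lfloor>log 2 \<bar>g x\<bar>\<rfloor>"
  have "{A \<in> bands n i g. x \<in> A} \<subseteq> (\<lambda>k::int. band_set n i g (2 powr k)) ` {L - 3..L}"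
  proof safe
    fix A assume A: "A \<in> bands n i g" "x \<in> A"
    then obtain k :: int where k: "A = band_set n i g (2 powr k)" by (auto simp: bands_def)
    then have b: "2 powr k < \<bar>g x\<bar>" "\<bar>g x\<bar> < 2 powr 4 * 2 powr k"
      using band_set_bounds[of x n i g "2 powr k"] A by auto
    then have pos: "0 < \<bar>g x\<bar>" by (smt (verit) powr_gt_zero)
    have "k < log 2 \<bar>g x\<bar>" using b(1) pos by (simp add: less_log_iff)
    moreover have "log 2 \<bar>g x\<bar> < 4 + k" using b(2) pos by (simp add: log_less_iff powr_add)
    ultimately have "k \<in> {L - 3..L}" unfolding L_def by (simp, linarith)
    then show "A \<in> (\<lambda>k::int. band_set n i g (2 powr k)) ` {L - 3..L}" using k by blast
  qed
  moreover have "card ((\<lambda>k::int. band_set n i g (2 powr k)) ` {L - 3..L}) \<le> 4"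
    using card_image_le[of "{L - 3..L}"] by force
  ultimately show "finite {A \<in> bands n i g. x \<in> A}" "card {A \<in> bands n i g. x \<in> A} \<le> 4"
    using finite_subset card_mono by (blast, metis (no_types, lifting) finite_atLeastAtMost_int finite_imageI le_trans)
qed

text \<open>The open cores reach from \<open>2 powr (k + 1)\<close> to
  \<open>2 powr (k + 3)\<close>; consecutive ones overlap, so every nonzero value is caught, powers
  of two included.\<close>

lemma ex_band_set:
  assumes "x \<in> Rn n" "g x \<noteq> 0"
  obtains k :: int where "x \<in> band_set n i g (2 powr k)"
proof
  define k where "k = \<lceil>log 2 \<bar>g x\<bar>\<rceil> - 2"
  have "k + 1 < log 2 \<bar>g x\<bar>" "log 2 \<bar>g x\<bar> < k + 3"
    unfolding k_def by (simp, linarith)+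
  then have "2 powr (k + 1) < \<bar>g x\<bar>" "\<bar>g x\<bar> < 2 powr (k + 3)"
    using assms(2) by (simp_all add: less_log_iff log_less_iff)
  then show "x \<in> band_set n i g (2 powr k)"
    by (intro in_band_set assms) (auto simp: powr_add)
qed

theorem theorem2p1:
  fixes j :: nat
  assumes "j \<ge> 1"
  shows "\<exists>C::real. C > 0 \<and>
    (\<forall>n\<ge>1. \<forall>i\<in>{1..n}. \<forall>u\<in>Ck_c n (j + 1).
      \<exists>P :: (nat \<Rightarrow> real) set set.
        (\<forall>A\<in>P. A \<in> sets (Rn_lebesgue n) \<and>
               0 < emeasure (Rn_lebesgue n) A \<and> emeasure (Rn_lebesgue n) A < \<infinity>) \<and>
        (\<forall>x\<in>Rn n.
           \<bar>(partial_deriv i ^^ j) u x\<bar>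
             \<le> C * enn2real (averaging_op (Rn_lebesgue n) P ((partial_deriv i ^^ (j + 1)) u) x)
                     powr (real j / real (j + 1))
                 * enn2real (averaging_op (Rn_lebesgue n) P u x) powr (1 / real (j + 1))) \<and>
        (\<forall>x\<in>Rn n. (\<Sum>\<^sub>\<infinity>A\<in>P. indicator A x :: ennreal) \<le> 5))"
proof (intro exI[of _ "32 * 2 ^ (\<Sum>k<j. k + 2)"] conjI allI impI ballI)
  fix n i :: nat and u :: "(nat \<Rightarrow> real) \<Rightarrow> real"
  assume i: "i \<in> {1..n}" and u: "u \<in> Ck_c n (j + 1)"
  let ?g = "(partial_deriv i ^^ j) u" and ?d = "(partial_deriv i ^^ (j + 1)) u"
  let ?M = "Rn_lebesgue n" and ?P = "bands n i ((partial_deriv i ^^ j) u)"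
  let ?K = "2 ^ (\<Sum>k<j. k + 2) :: real"
  let ?S = "Rn_top n closure_of {x \<in> Rn n. u x \<noteq> 0}"
  have Ck: "Ck n (j + 1) u" and S: "compactin (Rn_top n) ?S" using u by (auto simp: Ck_c_def)
  have "{x \<in> Rn n. u x \<noteq> 0} \<subseteq> ?S" by (intro closure_of_subset) auto
  then have "u x = 0" if "x \<in> Rn n - ?S" for x using that by blast
  note avg = band_set_average[OF Ck i _ assms S closedin_closure_of this]
  have P: "A \<in> sets ?M" "0 < emeasure ?M A" "emeasure ?M A < \<infinity>"
    "average ?M ?d A < \<infinity>" "average ?M u A < \<infinity>" if "A \<in> ?P" for A
  proof -
    obtain k :: int where k: "A = band_set n i ?g (2 powr k)" "A \<noteq> {}"
      using \<open>A \<in> ?P\<close> by (auto simp: bands_def)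
    then show "A \<in> sets ?M" "0 < emeasure ?M A" "emeasure ?M A < \<infinity>"
      "average ?M ?d A < \<infinity>" "average ?M u A < \<infinity>"
      using avg(1-5)[of "2 powr k"] by auto
  qed
  have bound: "\<bar>?g x\<bar> \<le> 32 * ?K * enn2real (averaging_op ?M ?P ?d x) powr (real j / real (j + 1))
                 * enn2real (averaging_op ?M ?P u x) powr (1 / real (j + 1))" if x: "x \<in> Rn n" for x
  proof (cases "?g x = 0")
    case True
    then show ?thesis by simp
  next
    case False
    then obtain k :: int where k: "x \<in> band_set n i ?g (2 powr k)" using ex_band_set[OF x] by blast
    define A where "A = band_set n i ?g (2 powr k)"
    have A: "A \<in> ?P" "x \<in> A" using k by (auto simp: A_def bands_def)
    \<comment> \<open>The constant \<open>32 * ?K\<close> is the product of 16 from the top of the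
      band, 2 from the optimisation over \<open>l\<close>, and \<open>?K\<close> from the interval
      estimate.\<close>
    have "\<bar>?g x\<bar> \<le> 16 * 2 powr k" using band_set_bounds[OF k] by auto
    also have "\<dots> \<le> 32 * ?K * (enn2real (average ?M ?d A) powr (real j / real (j + 1))
       * enn2real (average ?M u A) powr (1 / real (j + 1)))"
      using avg(6)[of "2 powr k"] A(2) unfolding A_def by (auto simp: field_simps)
    \<comment> \<open>The average over the single set \<open>A\<close> is one summand of the
      averaging operator at \<open>x\<close>, and both exponents are positive.\<close>
    also have "\<dots> \<le> 32 * ?K * (enn2real (averaging_op ?M ?P ?d x) powr (real j / real (j + 1))
       * enn2real (averaging_op ?M ?P u x) powr (1 / real (j + 1)))"
      using A P by (intro mult_left_mono mult_mono powr_mono2 average_le_averaging_op bands_overlap) auto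
    finally show ?thesis by (simp add: mult.assoc)
  qed
  have overlap: "(\<Sum>\<^sub>\<infinity>A\<in>?P. indicator A x :: ennreal) \<le> 5" for x
  proof -
    have "(\<Sum>\<^sub>\<infinity>A\<in>?P. indicator A x :: ennreal) = of_nat (card {A \<in> ?P. x \<in> A})"
      using infsum_indicator_finite[OF bands_overlap(1), where f = "\<lambda>_. 1"] by simp
    also have "\<dots> \<le> of_nat 5" using bands_overlap(2) by (intro of_nat_mono) (meson le_trans numeral_le_iff semiring_norm)
    finally show ?thesis by simp
  qed
  show "\<exists>P :: (nat \<Rightarrow> real) set set.
        (\<forall>A\<in>P. A \<in> sets (Rn_lebesgue n) \<and>
               0 < emeasure (Rn_lebesgue n) A \<and> emeasure (Rn_lebesgue n) A < \<infinity>) \<and>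
        (\<forall>x\<in>Rn n.
           \<bar>(partial_deriv i ^^ j) u x\<bar>
             \<le> 32 * 2 ^ (\<Sum>k<j. k + 2) * enn2real (averaging_op (Rn_lebesgue n) P ((partial_deriv i ^^ (j + 1)) u) x)
                     powr (real j / real (j + 1))
                 * enn2real (averaging_op (Rn_lebesgue n) P u x) powr (1 / real (j + 1))) \<and>
        (\<forall>x\<in>Rn n. (\<Sum>\<^sub>\<infinity>A\<in>P. indicator A x :: ennreal) \<le> 5)"
    using P bound overlap by (intro exI[of _ ?P]) blast
qed simp

end
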